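(* Let $\mathbf D=(D,\sqcup,\sqcap,\neg,\lrcorner,\top,\bot)$ be a fully contextual double Boolean algebra. Then the map $h:D\to\mathfrak R^T(\mathbb K^T_{pr}(\mathbf D))$, $h(x):=(F_{\neg x},I_x)$, is a dBa isomorphism from $\mathbf D$ onto the algebra $\underline{\mathfrak R}^T(\mathbb K^T_{pr}(\mathbf D))$ of clopen object oriented protoconcepts. In particular $\mathbf D$ is isomorphic to $\underline{\mathfrak R}^T(\mathbb K^T_{pr}(\mathbf D))$.
   Context: A double Boolean algebra (dBa) is an algebra $\mathbf{D}=(D,\sqcup,\sqcap,\neg,\lrcorner,\top,\bot)$ of type $(2,2,1,1,0,0)$ such that, with $x\vee y:=\neg(\neg x\sqcap\neg y)$ and $x\wedge y:=\lrcorner(\lrcorner x\sqcup\lrcorner y)$, for all $x,y,z\in D$: $(x\sqcap x)\sqcap y=x\sqcap y$; $x\sqcap y=y\sqcap x$; $x\sqcap(y\sqcap z)=(x\sqcap y)\sqcap z$; $\neg(x\sqcap x)=\neg x$; $x\sqcap(x\sqcup y)=x\sqcap x$; $x\sqcap(y\vee z)=(x\sqcap y)\vee(x\sqcap z)$; $x\sqcap(x\vee y)=x\sqcap x$; $\neg\neg(x\sqcap y)=x\sqcap y$; $x\sqcap\neg x=\bot$; $\neg\bot=\top\sqcap\top$; $\neg\top=\bot$; the duals $(x\sqcup x)\sqcup y=x\sqcup y$; $x\sqcup y=y\sqcup x$; $x\sqcup(y\sqcup z)=(x\sqcup y)\sqcup z$; $\lrcorner(x\sqcup x)=\lrcorner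 x$; $x\sqcup(x\sqcap y)=x\sqcup x$; $x\sqcup(y\wedge z)=(x\sqcup y)\wedge(x\sqcup z)$; $x\sqcup(x\wedge y)=x\sqcup x$; $\lrcorner\lrcorner(x\sqcup y)=x\sqcup y$; $x\sqcup\lrcorner x=\top$; $\lrcorner\top=\bot\sqcup\bot$; $\lrcorner\bot=\top$; and $(x\sqcap x)\sqcup(x\sqcap x)=(x\sqcup x)\sqcap(x\sqcup x)$. The quasi-order is $x\sqsubseteq y$ iff $x\sqcap y=x\sqcap x$ and $x\sqcup y=y\sqcup y$. Write $x_\sqcap:=x\sqcap x$, $x_\sqcup:=x\sqcup x$, $D_\sqcap:=\{x:x\sqcap x=x\}$, $D_\sqcup:=\{x:x\sqcup x=x\}$. $\mathbf D$ is contextual if $\sqsubseteq$ is a partial order, and fully contextual if it is contextual and for all $y\in D_\sqcap$, $x\in D_\sqcup$ with $y_\sqcup=x_\sqcap$ there is a unique $z\in D$ with $z_\sqcap=y$ and $z_\sqcup=x$. A dBa isomorphism is a bijection preserving $\sqcup,\sqcap,\neg,\lrcorner,\top,\bot$. A filter is $F\subseteq D$ closed under $\sqcap$ and upward closed for $\sqsubseteq$; an ideal is $I\subseteq D$ closed under $\sqcup$ and downward closed. A primary filter is a filter $F\ne D$ with $x\in F$ or $\neg x\in F$ for every $x$; a primary ideal is an ideal $I\ne D$ with $x\in I$ or $\lrcorner x\in I$ for every $x$. $\mathcal F_{pr}(\mathbf D)$, $\mathcal I_{pr}(\mathbf D)$ are the sets of these; $F_x:=\{F\in\mathcal F_{pr}(\mathbf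 D):x\in F\}$, $I_x:=\{I\in\mathcal I_{pr}(\mathbf D):x\in I\}$. $\mathcal T$ is the topology on $\mathcal F_{pr}(\mathbf D)$ with subbase of closed sets $\{F_x\}$, $\mathcal J$ the topology on $\mathcal I_{pr}(\mathbf D)$ with subbase of closed sets $\{I_x\}$; $\mathbb K^T_{pr}(\mathbf D):=((\mathcal F_{pr}(\mathbf D),\mathcal T),(\mathcal I_{pr}(\mathbf D),\mathcal J),\nabla)$ where $F\nabla I$ iff $F\cap I=\emptyset$. For a relation $R\subseteq G\times M$, $A\subseteq G$, $B\subseteq M$: $A^{\blacksquare}:=\{m:R^{-1}(m)\subseteq A\}$, $B^{\lozenge}:=\{g:R(g)\cap B\neq\emptyset\}$. An object oriented protoconcept is a pair $(A,B)$ with $A^{\blacksquare\lozenge}=B^{\lozenge}$. Operations on pairs: $(A,B)\sqcap(C,D)=(A\cup C,(A\cup C)^{\blacksquare})$, $(A,B)\sqcup(C,D)=((B\cap D)^{\lozenge},B\cap D)$, $\neg(A,B)=(A^c,A^{c\blacksquare})$, $\lrcorner(A,B)=(B^{c\lozenge},B^c)$, $\top=(\emptyset,\emptyset)$, $\bot=(G,M)$. For a context on topological spaces $((G,\rho),(M,\tau),R)$, $\mathfrak R^T$ is the set of object oriented protoconcepts $(A,B)$ with $A$ clopen in $G$ and $B$ clopen in $M$, and $\underline{\mathfrak R}^T$ is this set with the operations above. *)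

theory Defs
  imports "HOL-Analysis.Abstract_Topology" "HOL-Algebra.Congruence"
begin

section \<open>Double Boolean algebras\<close>

record 'a dba = "'a partial_object" +
  djoin :: "'a \<Rightarrow> 'a \<Rightarrow> 'a"  (infixl "\<squnion>\<index>" 65)
  dmeet :: "'a \<Rightarrow> 'a \<Rightarrow> 'a"  (infixl "\<sqinter>\<index>" 70)
  dneg :: "'a \<Rightarrow> 'a"  ("\<^bold>\<not>\<index> _" [81] 80)
  dopp :: "'a \<Rightarrow> 'a"  ("\<^bold>\<rfloor>\<index> _" [81] 80)
  dtop :: 'a  ("\<top>\<index>")
  dbot :: 'a  ("\<bottom>\<index>")

definition dvee :: "('a, 'b) dba_scheme \<Rightarrow> 'a \<Rightarrow> 'a \<Rightarrow> 'a"  (infixl "\<^bold>\<or>\<index>" 65)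
  where "x \<^bold>\<or>\<^bsub>D\<^esub> y = \<^bold>\<not>\<^bsub>D\<^esub> (\<^bold>\<not>\<^bsub>D\<^esub> x \<sqinter>\<^bsub>D\<^esub> \<^bold>\<not>\<^bsub>D\<^esub> y)"

definition dwedge :: "('a, 'b) dba_scheme \<Rightarrow> 'a \<Rightarrow> 'a \<Rightarrow> 'a"  (infixl "\<^bold>\<and>\<index>" 70)
  where "x \<^bold>\<and>\<^bsub>D\<^esub> y = \<^bold>\<rfloor>\<^bsub>D\<^esub> (\<^bold>\<rfloor>\<^bsub>D\<^esub> x \<squnion>\<^bsub>D\<^esub> \<^bold>\<rfloor>\<^bsub>D\<^esub> y)"

definition dle :: "('a, 'b) dba_scheme \<Rightarrow> 'a \<Rightarrow> 'a \<Rightarrow> bool"  (infix "\<sqsubseteq>\<index>" 50)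
  where "x \<sqsubseteq>\<^bsub>D\<^esub> y \<longleftrightarrow> x \<sqinter>\<^bsub>D\<^esub> y = x \<sqinter>\<^bsub>D\<^esub> x \<and> x \<squnion>\<^bsub>D\<^esub> y = y \<squnion>\<^bsub>D\<^esub> y"

text \<open>The sets $D_\sqcap$ and $D_\sqcup$.\<close>

definition meet_part :: "('a, 'b) dba_scheme \<Rightarrow> 'a set"
  where "meet_part D = {x \<in> carrier D. x \<sqinter>\<^bsub>D\<^esub> x = x}"

definition join_part :: "('a, 'b) dba_scheme \<Rightarrow> 'a set"
  where "join_part D = {x \<in> carrier D. x \<squnion>\<^bsub>D\<^esub> x = x}"

locale double_boolean_algebra =
  fixes D (structure)
  assumes join_closed: "\<lbrakk>x \<in> carrier D; y \<in> carrier D\<rbrakk> \<Longrightarrow> x \<squnion> y \<in> carrier D"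
    and meet_closed: "\<lbrakk>x \<in> carrier D; y \<in> carrier D\<rbrakk> \<Longrightarrow> x \<sqinter> y \<in> carrier D"
    and neg_closed: "x \<in> carrier D \<Longrightarrow> \<^bold>\<not> x \<in> carrier D"
    and opp_closed: "x \<in> carrier D \<Longrightarrow> \<^bold>\<rfloor> x \<in> carrier D"
    and top_closed: "\<top> \<in> carrier D"
    and bot_closed: "\<bottom> \<in> carrier D"
    and meet_idem_left: "\<lbrakk>x \<in> carrier D; y \<in> carrier D\<rbrakk> \<Longrightarrow> (x \<sqinter> x) \<sqinter> y = x \<sqinter> y"
    and meet_comm: "\<lbrakk>x \<in> carrier D; y \<in> carrier D\<rbrakk> \<Longrightarrow> x \<sqinter> y = y \<sqinter> x"
    and meet_assoc: "\<lbrakk>x \<in> carrier D; y \<in> carrier D; z \<in> carrier D\<rbrakk>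
          \<Longrightarrow> x \<sqinter> (y \<sqinter> z) = (x \<sqinter> y) \<sqinter> z"
    and neg_meet_idem: "x \<in> carrier D \<Longrightarrow> \<^bold>\<not> (x \<sqinter> x) = \<^bold>\<not> x"
    and meet_join_absorb: "\<lbrakk>x \<in> carrier D; y \<in> carrier D\<rbrakk> \<Longrightarrow> x \<sqinter> (x \<squnion> y) = x \<sqinter> x"
    and meet_vee_distrib: "\<lbrakk>x \<in> carrier D; y \<in> carrier D; z \<in> carrier D\<rbrakk>
          \<Longrightarrow> x \<sqinter> (y \<^bold>\<or> z) = (x \<sqinter> y) \<^bold>\<or> (x \<sqinter> z)"
    and meet_vee_absorb: "\<lbrakk>x \<in> carrier D; y \<in> carrier D\<rbrakk> \<Longrightarrow> x \<sqinter> (x \<^bold>\<or> y) = x \<sqinter> x"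
    and neg_neg_meet: "\<lbrakk>x \<in> carrier D; y \<in> carrier D\<rbrakk> \<Longrightarrow> \<^bold>\<not> (\<^bold>\<not> (x \<sqinter> y)) = x \<sqinter> y"
    and meet_neg: "x \<in> carrier D \<Longrightarrow> x \<sqinter> \<^bold>\<not> x = \<bottom>"
    and neg_bot: "\<^bold>\<not> \<bottom> = \<top> \<sqinter> \<top>"
    and neg_top: "\<^bold>\<not> \<top> = \<bottom>"
    and join_idem_left: "\<lbrakk>x \<in> carrier D; y \<in> carrier D\<rbrakk> \<Longrightarrow> (x \<squnion> x) \<squnion> y = x \<squnion> y"
    and join_comm: "\<lbrakk>x \<in> carrier D; y \<in> carrier D\<rbrakk> \<Longrightarrow> x \<squnion> y = y \<squnion> x"
    and join_assoc: "\<lbrakk>x \<in> carrier D; y \<in> carrier D; z \<in> carrier D\<rbrakk>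
          \<Longrightarrow> x \<squnion> (y \<squnion> z) = (x \<squnion> y) \<squnion> z"
    and opp_join_idem: "x \<in> carrier D \<Longrightarrow> \<^bold>\<rfloor> (x \<squnion> x) = \<^bold>\<rfloor> x"
    and join_meet_absorb: "\<lbrakk>x \<in> carrier D; y \<in> carrier D\<rbrakk> \<Longrightarrow> x \<squnion> (x \<sqinter> y) = x \<squnion> x"
    and join_wedge_distrib: "\<lbrakk>x \<in> carrier D; y \<in> carrier D; z \<in> carrier D\<rbrakk>
          \<Longrightarrow> x \<squnion> (y \<^bold>\<and> z) = (x \<squnion> y) \<^bold>\<and> (x \<squnion> z)"
    and join_wedge_absorb: "\<lbrakk>x \<in> carrier D; y \<in> carrier D\<rbrakk> \<Longrightarrow> x \<squnion> (x \<^bold>\<and> y) = x \<squnion> x"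
    and opp_opp_join: "\<lbrakk>x \<in> carrier D; y \<in> carrier D\<rbrakk> \<Longrightarrow> \<^bold>\<rfloor> (\<^bold>\<rfloor> (x \<squnion> y)) = x \<squnion> y"
    and join_opp: "x \<in> carrier D \<Longrightarrow> x \<squnion> \<^bold>\<rfloor> x = \<top>"
    and opp_top: "\<^bold>\<rfloor> \<top> = \<bottom> \<squnion> \<bottom>"
    and opp_bot: "\<^bold>\<rfloor> \<bottom> = \<top>"
    and meet_join_idem: "x \<in> carrier D
          \<Longrightarrow> (x \<sqinter> x) \<squnion> (x \<sqinter> x) = (x \<squnion> x) \<sqinter> (x \<squnion> x)"

locale contextual_dba = double_boolean_algebra +
  assumes le_partial_order:
    "partial_order_on (carrier D) {(x, y). x \<in> carrier D \<and> y \<in> carrier D \<and> x \<sqsubseteq> y}"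

locale fully_contextual_dba = contextual_dba +
  assumes ex1_glue: "\<lbrakk>y \<in> meet_part D; x \<in> join_part D; y \<squnion> y = x \<sqinter> x\<rbrakk>
    \<Longrightarrow> \<exists>!z. z \<in> carrier D \<and> z \<sqinter> z = y \<and> z \<squnion> z = x"

definition dba_iso :: "('a, 'c) dba_scheme \<Rightarrow> ('b, 'd) dba_scheme \<Rightarrow> ('a \<Rightarrow> 'b) set"
  where "dba_iso D E = {h. bij_betw h (carrier D) (carrier E) \<and>
    (\<forall>x\<in>carrier D. \<forall>y\<in>carrier D. h (x \<squnion>\<^bsub>D\<^esub> y) = h x \<squnion>\<^bsub>E\<^esub> h y) \<and>
    (\<forall>x\<in>carrier D. \<forall>y\<in>carrier D. h (x \<sqinter>\<^bsub>D\<^esub> y) = h x \<sqinter>\<^bsub>E\<^esub> h y) \<and>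
    (\<forall>x\<in>carrier D. h (\<^bold>\<not>\<^bsub>D\<^esub> x) = \<^bold>\<not>\<^bsub>E\<^esub> h x) \<and>
    (\<forall>x\<in>carrier D. h (\<^bold>\<rfloor>\<^bsub>D\<^esub> x) = \<^bold>\<rfloor>\<^bsub>E\<^esub> h x) \<and>
    h \<top>\<^bsub>D\<^esub> = \<top>\<^bsub>E\<^esub> \<and> h \<bottom>\<^bsub>D\<^esub> = \<bottom>\<^bsub>E\<^esub>}"

definition dba_isomorphic :: "('a, 'c) dba_scheme \<Rightarrow> ('b, 'd) dba_scheme \<Rightarrow> bool"
  where "dba_isomorphic D E \<longleftrightarrow> dba_iso D E \<noteq> {}"

lemma (in double_boolean_algebra) dba_iso_imp_dba:
  assumes "h \<in> dba_iso D E"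
  shows "double_boolean_algebra E"
proof -
  have bij: "bij_betw h (carrier D) (carrier E)"
    and hom: "\<And>x y. \<lbrakk>x \<in> carrier D; y \<in> carrier D\<rbrakk> \<Longrightarrow> h x \<squnion>\<^bsub>E\<^esub> h y = h (x \<squnion> y)"
      "\<And>x y. \<lbrakk>x \<in> carrier D; y \<in> carrier D\<rbrakk> \<Longrightarrow> h x \<sqinter>\<^bsub>E\<^esub> h y = h (x \<sqinter> y)"
      "\<And>x. x \<in> carrier D \<Longrightarrow> \<^bold>\<not>\<^bsub>E\<^esub> h x = h (\<^bold>\<not> x)"
      "\<And>x. x \<in> carrier D \<Longrightarrow> \<^bold>\<rfloor>\<^bsub>E\<^esub> h x = h (\<^bold>\<rfloor> x)"
      "\<top>\<^bsub>E\<^esub> = h \<top>" "\<bottom>\<^bsub>E\<^esub> = h \<bottom>"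
    using assms by (auto simp: dba_iso_def)
  have carr: "carrier E = h ` carrier D"
    using bij by (simp add: bij_betw_def)
  note closed = join_closed meet_closed neg_closed opp_closed top_closed bot_closed
  have vee: "h x \<^bold>\<or>\<^bsub>E\<^esub> h y = h (x \<^bold>\<or> y)" "h x \<^bold>\<and>\<^bsub>E\<^esub> h y = h (x \<^bold>\<and> y)"
    "x \<^bold>\<or> y \<in> carrier D" "x \<^bold>\<and> y \<in> carrier D"
    if "x \<in> carrier D" "y \<in> carrier D" for x y
    using that by (simp_all add: dvee_def dwedge_def hom closed)
  show ?thesis
    by unfold_locales
      (auto simp: carr hom vee closed meet_idem_left neg_meet_idem meet_join_absorb
          meet_vee_distrib[symmetric] meet_vee_absorb neg_neg_meet meet_neg neg_bot neg_top
          join_idem_left opp_join_idem join_meet_absorb join_wedge_distrib[symmetric]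
          join_wedge_absorb opp_opp_join join_opp opp_top opp_bot meet_join_idem
          meet_assoc join_assoc
        intro: meet_comm[THEN arg_cong[where f = h]] join_comm[THEN arg_cong[where f = h]])
qed


section \<open>Primary filters and ideals\<close>

definition dba_filter :: "('a, 'b) dba_scheme \<Rightarrow> 'a set \<Rightarrow> bool"
  where "dba_filter D F \<longleftrightarrow> F \<subseteq> carrier D \<and> (\<forall>x\<in>F. \<forall>y\<in>F. x \<sqinter>\<^bsub>D\<^esub> y \<in> F) \<and>
    (\<forall>x\<in>F. \<forall>y\<in>carrier D. x \<sqsubseteq>\<^bsub>D\<^esub> y \<longrightarrow> y \<in> F)"

definition dba_ideal :: "('a, 'b) dba_scheme \<Rightarrow> 'a set \<Rightarrow> bool"
  where "dba_ideal D I \<longleftrightarrow> I \<subseteq> carrier D \<and> (\<forall>x\<in>I. \<forall>y\<in>I. x \<squnion>\<^bsub>D\<^esub> y \<in> I) \<and>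
    (\<forall>x\<in>I. \<forall>y\<in>carrier D. y \<sqsubseteq>\<^bsub>D\<^esub> x \<longrightarrow> y \<in> I)"

definition primary_filters :: "('a, 'b) dba_scheme \<Rightarrow> 'a set set"
  where "primary_filters D =
    {F. dba_filter D F \<and> F \<noteq> carrier D \<and> (\<forall>x\<in>carrier D. x \<in> F \<or> \<^bold>\<not>\<^bsub>D\<^esub> x \<in> F)}"

definition primary_ideals :: "('a, 'b) dba_scheme \<Rightarrow> 'a set set"
  where "primary_ideals D =
    {I. dba_ideal D I \<and> I \<noteq> carrier D \<and> (\<forall>x\<in>carrier D. x \<in> I \<or> \<^bold>\<rfloor>\<^bsub>D\<^esub> x \<in> I)}"

definition filters_at :: "('a, 'b) dba_scheme \<Rightarrow> 'a \<Rightarrow> 'a set set"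
  where "filters_at D x = {F \<in> primary_filters D. x \<in> F}"

definition ideals_at :: "('a, 'b) dba_scheme \<Rightarrow> 'a \<Rightarrow> 'a set set"
  where "ideals_at D x = {I \<in> primary_ideals D. x \<in> I}"

text \<open>The coarsest topology on \<open>X\<close> in which every member of \<open>\<C>\<close> (a family of subsets
  of \<open>X\<close>) is closed.\<close>

definition closed_subbase_topology :: "'a set \<Rightarrow> 'a set set \<Rightarrow> 'a topology"
  where "closed_subbase_topology X \<C> = topology
    (arbitrary union_of (finite intersection_of (\<lambda>U. \<exists>C\<in>\<C>. U = X - C) relative_to X))"


section \<open>Contexts on topological spaces and object oriented protoconcepts\<close>

record ('g, 'm) top_context =
  obj_top :: "'g topology"
  attr_top :: "'m topology"
  incidence :: "('g \<times> 'm) set"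

text \<open>The operators $A^{\blacksquare}$ and $B^{\lozenge}$.\<close>

definition nec :: "('g, 'm, 'z) top_context_scheme \<Rightarrow> 'g set \<Rightarrow> 'm set"
  where "nec K A = {m \<in> topspace (attr_top K). (incidence K)\<inverse> `` {m} \<subseteq> A}"

definition poss :: "('g, 'm, 'z) top_context_scheme \<Rightarrow> 'm set \<Rightarrow> 'g set"
  where "poss K B = {g \<in> topspace (obj_top K). incidence K `` {g} \<inter> B \<noteq> {}}"

definition oo_protoconcepts :: "('g, 'm, 'z) top_context_scheme \<Rightarrow> ('g set \<times> 'm set) set"
  where "oo_protoconcepts K = {(A, B). A \<subseteq> topspace (obj_top K) \<and> B \<subseteq> topspace (attr_top K) \<and>
    poss K (nec K A) = poss K B}"

definition clopen_oo_protoconcepts :: "('g, 'm, 'z) top_context_scheme \<Rightarrow> ('g set \<times> 'm set) set"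
  where "clopen_oo_protoconcepts K = {(A, B) \<in> oo_protoconcepts K.
    closedin (obj_top K) A \<and> openin (obj_top K) A \<and>
    closedin (attr_top K) B \<and> openin (attr_top K) B}"

definition clopen_oo_protoconcept_algebra ::
    "('g, 'm, 'z) top_context_scheme \<Rightarrow> ('g set \<times> 'm set) dba"
  where "clopen_oo_protoconcept_algebra K = \<lparr>
    carrier = clopen_oo_protoconcepts K,
    djoin = (\<lambda>(A, B) (C, E). (poss K (B \<inter> E), B \<inter> E)),
    dmeet = (\<lambda>(A, B) (C, E). (A \<union> C, nec K (A \<union> C))),
    dneg = (\<lambda>(A, B). (topspace (obj_top K) - A, nec K (topspace (obj_top K) - A))),
    dopp = (\<lambda>(A, B). (poss K (topspace (attr_top K) - B), topspace (attr_top K) - B)),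
    dtop = ({}, {}),
    dbot = (topspace (obj_top K), topspace (attr_top K))\<rparr>"

definition primary_context :: "('a, 'b) dba_scheme \<Rightarrow> ('a set, 'a set) top_context"
  where "primary_context D = \<lparr>
    obj_top = closed_subbase_topology (primary_filters D) (filters_at D ` carrier D),
    attr_top = closed_subbase_topology (primary_ideals D) (ideals_at D ` carrier D),
    incidence = {(F, I). F \<in> primary_filters D \<and> I \<in> primary_ideals D \<and> F \<inter> I = {}}\<rparr>"

lemma topspace_primary_context [simp]:
  "topspace (obj_top (primary_context D)) = primary_filters D"
  "topspace (attr_top (primary_context D)) = primary_ideals D"
  by (simp_all add: primary_context_def closed_subbase_topology_def topspace_subbase)

end

theory Submission
  imports Defs "HOL-Analysis.Sigma_Algebra"
begin

text \<open>This is Stone duality for the Boolean algebra $D_\sqcap$ and, by exchanging the two halves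
  of $\mathbf D$, for $D_\sqcup$. Primary filters play the role of ultrafilters: by Zorn's lemma a
  filter disjoint from a nonempty down-set closed under $\vee$ extends to a primary filter still
  disjoint from it. Taking for the down-set a principal one shows that $F_x$ determines $x_\sqcap$;
  taking the set of $w$ such that $F_w$ is covered by finitely many members of an open cover shows
  that the primary filters form a compact space, whose clopen sets are therefore exactly the $F_x$;
  and taking a primary ideal computes $\blacksquare$ and $\lozenge$ on the sets $F_x$ and $I_x$.
  A clopen protoconcept thus amounts to a pair $p \in D_\sqcap$, $q \in D_\sqcup$ with
  $p_\sqcup = q_\sqcap$, which in a fully contextual algebra is the same thing as an element.\<close>

section \<open>Topologies generated by an algebra of sets\<close>

lemma topspace_closed_subbase_topology [simp]: "topspace (closed_subbase_topology X \<C>) = X"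
  by (simp add: closed_subbase_topology_def)

context algebra
begin

lemma finite_intersection_of_complements_relative_to:
  "((finite intersection_of (\<lambda>U. \<exists>C\<in>M. U = \<Omega> - C)) relative_to \<Omega>) = (\<lambda>U. U \<in> M)"
proof (intro ext iffI)
  fix U assume "((finite intersection_of (\<lambda>U. \<exists>C\<in>M. U = \<Omega> - C)) relative_to \<Omega>) U"
  then obtain \<U> where fin: "finite \<U>" and \<U>: "\<And>V. V \<in> \<U> \<Longrightarrow> \<exists>C\<in>M. V = \<Omega> - C"
    and U: "U = \<Omega> \<inter> \<Inter>\<U>"
    by (fastforce simp: relative_to_def intersection_of_def)
  from fin \<U> have "\<Omega> \<inter> \<Inter>\<U> \<in> M"
  proof (induction \<U>)
    case empty
    show ?case by simp
  next
    case (insert V \<U>)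
    then have "V \<in> M" "\<Omega> \<inter> \<Inter>\<U> \<in> M" by auto
    then have "V \<inter> (\<Omega> \<inter> \<Inter>\<U>) \<in> M" by (rule Int)
    then show ?case by (simp add: Int_left_commute)
  qed
  with U show "U \<in> M" by simp
next
  fix U assume U: "U \<in> M"
  then have "\<exists>C\<in>M. U = \<Omega> - C"
    using sets_into_space by (intro bexI[where x = "\<Omega> - U"]) auto
  then have "(finite intersection_of (\<lambda>U. \<exists>C\<in>M. U = \<Omega> - C)) U"
    by (rule finite_intersection_of_inc)
  with U show "((finite intersection_of (\<lambda>U. \<exists>C\<in>M. U = \<Omega> - C)) relative_to \<Omega>) U"
    by (intro relative_to_subset_inc sets_into_space)
qed

lemma openin_closed_subbase_topology_iff:
  "openin (closed_subbase_topology \<Omega> M) U \<longleftrightarrow> (\<forall>x\<in>U. \<exists>V\<in>M. x \<in> V \<and> V \<subseteq> U)"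
  unfolding closed_subbase_topology_def openin_subbase
  unfolding finite_intersection_of_complements_relative_to arbitrary_union_of_alt by blast

lemma clopen_closed_subbase_topology_iff:
  assumes "compact_space (closed_subbase_topology \<Omega> M)"
  shows "closedin (closed_subbase_topology \<Omega> M) A \<and> openin (closed_subbase_topology \<Omega> M) A
    \<longleftrightarrow> A \<in> M"
proof
  assume clopen: "closedin (closed_subbase_topology \<Omega> M) A \<and> openin (closed_subbase_topology \<Omega> M) A"
  have "\<forall>V\<in>{V \<in> M. V \<subseteq> A}. openin (closed_subbase_topology \<Omega> M) V"
    using openin_closed_subbase_topology_iff by auto
  moreover have "A \<subseteq> \<Union>{V \<in> M. V \<subseteq> A}"
    using clopen openin_closed_subbase_topology_iff by auto
  moreover have "compactin (closed_subbase_topology \<Omega> M) A"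
    using assms clopen by (simp add: closedin_compact_space)
  ultimately obtain \<F> where "finite \<F>" "\<F> \<subseteq> {V \<in> M. V \<subseteq> A}" "A \<subseteq> \<Union>\<F>"
    unfolding compactin_def by meson
  moreover from this have "A = \<Union>\<F>" by auto
  ultimately show "A \<in> M" by auto
next
  assume A: "A \<in> M"
  have "openin (closed_subbase_topology \<Omega> M) V" if "V \<in> M" for V
    using that by (auto simp: openin_closed_subbase_topology_iff)
  with A show "closedin (closed_subbase_topology \<Omega> M) A \<and> openin (closed_subbase_topology \<Omega> M) A"
    by (simp add: closedin_def sets_into_space compl_sets)
qed

end

section \<open>The quasi-order of a double Boolean algebra\<close>

context double_boolean_algebra
begin

lemmas operations_closed [simp] =
  join_closed meet_closed neg_closed opp_closed top_closed bot_closed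

lemma vee_closed [simp]: "\<lbrakk>x \<in> carrier D; y \<in> carrier D\<rbrakk> \<Longrightarrow> x \<^bold>\<or> y \<in> carrier D"
  by (simp add: dvee_def)

lemma meet_left_comm:
  assumes "x \<in> carrier D" "y \<in> carrier D" "z \<in> carrier D"
  shows "x \<sqinter> (y \<sqinter> z) = y \<sqinter> (x \<sqinter> z)"
  using assms by (simp add: meet_assoc meet_comm[of x y])

lemma meet_left_idem:
  assumes "x \<in> carrier D" "y \<in> carrier D"
  shows "x \<sqinter> (x \<sqinter> y) = x \<sqinter> y"
  using assms by (simp add: meet_assoc meet_idem_left)

lemma meet_right_idem:
  assumes "x \<in> carrier D" "y \<in> carrier D"
  shows "x \<sqinter> (y \<sqinter> y) = x \<sqinter> y"
  using assms by (metis meet_closed meet_comm meet_idem_left)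

lemmas meet_ac = meet_assoc[symmetric] meet_comm meet_left_comm meet_left_idem meet_right_idem

lemma neg_neg: "x \<in> carrier D \<Longrightarrow> \<^bold>\<not> (\<^bold>\<not> x) = x \<sqinter> x"
  by (metis neg_meet_idem neg_neg_meet)

lemma neg_eq_iff:
  assumes "x \<in> carrier D" "y \<in> carrier D"
  shows "\<^bold>\<not> x = \<^bold>\<not> y \<longleftrightarrow> x \<sqinter> x = y \<sqinter> y"
  using assms by (metis neg_meet_idem neg_neg)

lemma meet_top: "x \<in> carrier D \<Longrightarrow> x \<sqinter> \<top> = x \<sqinter> x"
  by (metis join_opp meet_join_absorb opp_closed)

lemma vee_neg: "x \<in> carrier D \<Longrightarrow> x \<^bold>\<or> \<^bold>\<not> x = \<top> \<sqinter> \<top>"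
  by (simp add: dvee_def meet_neg neg_bot)

lemma vee_meet_self:
  assumes "x \<in> carrier D" "y \<in> carrier D"
  shows "(x \<sqinter> x) \<^bold>\<or> (y \<sqinter> y) = x \<^bold>\<or> y"
  using assms by (simp add: dvee_def neg_meet_idem)

lemma meet_part_closed: "p \<in> meet_part D \<Longrightarrow> p \<in> carrier D"
  by (simp add: meet_part_def)

lemma meet_part_idem: "p \<in> meet_part D \<Longrightarrow> p \<sqinter> p = p"
  by (simp add: meet_part_def)

lemma meet_in_meet_part [simp]: "\<lbrakk>x \<in> carrier D; y \<in> carrier D\<rbrakk> \<Longrightarrow> x \<sqinter> y \<in> meet_part D"
  by (simp add: meet_part_def meet_ac)

lemma neg_in_meet_part [simp]: "x \<in> carrier D \<Longrightarrow> \<^bold>\<not> x \<in> meet_part D"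
  by (metis meet_in_meet_part neg_closed neg_meet_idem neg_neg)

lemma vee_in_meet_part [simp]:
  "\<lbrakk>x \<in> carrier D; y \<in> carrier D\<rbrakk> \<Longrightarrow> x \<^bold>\<or> y \<in> meet_part D"
  by (simp add: dvee_def)

lemma dle_refl: "x \<sqsubseteq> x"
  by (simp add: dle_def)

lemma dle_trans:
  assumes xyz: "x \<in> carrier D" "y \<in> carrier D" "z \<in> carrier D"
    and xy: "x \<sqsubseteq> y" and yz: "y \<sqsubseteq> z"
  shows "x \<sqsubseteq> z"
proof -
  have "x \<sqinter> z = (x \<sqinter> y) \<sqinter> z" using xyz xy by (simp add: dle_def meet_idem_left)
  also have "\<dots> = x \<sqinter> (y \<sqinter> z)" using xyz by (simp add: meet_assoc)
  also have "\<dots> = x \<sqinter> x" using xyz xy yz by (simp add: dle_def meet_right_idem)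
  finally have meet: "x \<sqinter> z = x \<sqinter> x" .
  have "x \<squnion> z = x \<squnion> (y \<squnion> z)" using xyz yz by (metis dle_def join_comm join_closed join_idem_left)
  also have "\<dots> = y \<squnion> z" using xyz xy by (simp add: dle_def join_assoc join_idem_left)
  also have "\<dots> = z \<squnion> z" using yz by (simp add: dle_def)
  finally show ?thesis using meet by (simp add: dle_def)
qed

lemma dle_iff_meet_eq:
  assumes "p \<in> meet_part D" "y \<in> carrier D"
  shows "p \<sqsubseteq> y \<longleftrightarrow> p \<sqinter> y = p"
proof
  assume "p \<sqinter> y = p"
  moreover have "y \<squnion> (y \<sqinter> p) = y \<squnion> y"
    using assms by (simp add: join_meet_absorb meet_part_closed)
  ultimately show "p \<sqsubseteq> y"
    using assms by (simp add: dle_def meet_part_closed meet_part_idem meet_comm join_comm)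
qed (use assms in \<open>simp add: dle_def meet_part_idem\<close>)

lemma meet_dle_left:
  assumes "x \<in> carrier D" "y \<in> carrier D"
  shows "x \<sqinter> y \<sqsubseteq> x"
  using assms by (simp add: dle_iff_meet_eq meet_ac)

lemma meet_dle_right:
  assumes "x \<in> carrier D" "y \<in> carrier D"
  shows "x \<sqinter> y \<sqsubseteq> y"
  using assms meet_dle_left[of y x] by (simp add: meet_comm)

lemma meet_greatest:
  assumes "p \<in> meet_part D" "x \<in> carrier D" "y \<in> carrier D" "p \<sqsubseteq> x" "p \<sqsubseteq> y"
  shows "p \<sqsubseteq> x \<sqinter> y"
  using assms by (simp add: dle_iff_meet_eq meet_assoc meet_part_closed)

lemma meet_mono:
  assumes "u \<in> carrier D" "v \<in> carrier D" "x \<in> carrier D" "y \<in> carrier D" "u \<sqsubseteq> x" "v \<sqsubseteq> y"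
  shows "u \<sqinter> v \<sqsubseteq> x \<sqinter> y"
  using assms dle_trans[OF _ _ _ meet_dle_left, of u v x] dle_trans[OF _ _ _ meet_dle_right, of u v y]
  by (simp add: meet_greatest)

lemma bot_dle: "x \<in> carrier D \<Longrightarrow> \<bottom> \<sqsubseteq> x"
  using meet_dle_left[of x "\<^bold>\<not> x"] by (simp add: meet_neg)

lemma vee_least:
  assumes "x \<in> carrier D" "y \<in> carrier D" "z \<in> carrier D" "x \<sqsubseteq> z" "y \<sqsubseteq> z"
  shows "x \<^bold>\<or> y \<sqsubseteq> z"
proof -
  have "z \<sqinter> (x \<^bold>\<or> y) = (x \<sqinter> x) \<^bold>\<or> (y \<sqinter> y)"
    using assms by (simp add: meet_vee_distrib dle_def meet_comm[of z])
  then show ?thesis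
    using assms by (simp add: dle_iff_meet_eq vee_meet_self meet_comm[of z])
qed

lemma vee_dle_join:
  assumes "x \<in> carrier D" "y \<in> carrier D"
  shows "x \<^bold>\<or> y \<sqsubseteq> x \<squnion> y"
proof -
  have "x \<sqinter> x \<sqsubseteq> x \<squnion> y" "y \<sqinter> y \<sqsubseteq> x \<squnion> y"
    using assms meet_join_absorb[of x y] meet_join_absorb[of y x]
    by (simp_all add: dle_iff_meet_eq meet_idem_left join_comm)
  then show ?thesis
    using assms vee_least[of "x \<sqinter> x" "y \<sqinter> y" "x \<squnion> y"] by (simp add: vee_meet_self)
qed

end

lemma (in contextual_dba) dle_antisym:
  assumes "x \<in> carrier D" "y \<in> carrier D" "x \<sqsubseteq> y" "y \<sqsubseteq> x"
  shows "x = y"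
  using le_partial_order assms by (auto simp: partial_order_on_def antisym_def)

lemma (in contextual_dba) eq_if_parts_eq:
  assumes "x \<in> carrier D" "y \<in> carrier D" "x \<sqinter> x = y \<sqinter> y" "x \<squnion> x = y \<squnion> y"
  shows "x = y"
proof (rule dle_antisym)
  show "x \<sqsubseteq> y" "y \<sqsubseteq> x"
    unfolding dle_def using assms by (metis join_idem_left meet_idem_left)+
qed (use assms in auto)

section \<open>Filters and their extension to primary filters\<close>

definition up_closure :: "('a, 'b) dba_scheme \<Rightarrow> 'a set \<Rightarrow> 'a set"
  where "up_closure D S = {x \<in> carrier D. \<exists>s\<in>S. s \<sqsubseteq>\<^bsub>D\<^esub> x}"

text \<open>Since $x \vee y \sqsubseteq x \sqcup y$, this is weaker than being a nonempty ideal of $D$.\<close>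

definition vee_ideal :: "('a, 'b) dba_scheme \<Rightarrow> 'a set \<Rightarrow> bool"
  where "vee_ideal D J \<longleftrightarrow> J \<subseteq> carrier D \<and> J \<noteq> {} \<and> (\<forall>x\<in>J. \<forall>y\<in>J. x \<^bold>\<or>\<^bsub>D\<^esub> y \<in> J) \<and>
    (\<forall>x\<in>J. \<forall>y\<in>carrier D. y \<sqsubseteq>\<^bsub>D\<^esub> x \<longrightarrow> y \<in> J)"

context double_boolean_algebra
begin

lemma filter_closed: "\<lbrakk>dba_filter D F; x \<in> F\<rbrakk> \<Longrightarrow> x \<in> carrier D"
  by (auto simp: dba_filter_def)

lemma filter_meet: "\<lbrakk>dba_filter D F; x \<in> F; y \<in> F\<rbrakk> \<Longrightarrow> x \<sqinter> y \<in> F"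
  by (simp add: dba_filter_def)

lemma filter_up: "\<lbrakk>dba_filter D F; x \<in> F; y \<in> carrier D; x \<sqsubseteq> y\<rbrakk> \<Longrightarrow> y \<in> F"
  by (simp add: dba_filter_def)

lemma vee_ideal_vee: "\<lbrakk>vee_ideal D J; x \<in> J; y \<in> J\<rbrakk> \<Longrightarrow> x \<^bold>\<or> y \<in> J"
  by (simp add: vee_ideal_def)

lemma vee_ideal_down: "\<lbrakk>vee_ideal D J; x \<in> J; y \<in> carrier D; y \<sqsubseteq> x\<rbrakk> \<Longrightarrow> y \<in> J"
  by (simp add: vee_ideal_def)

lemma filter_up_closure:
  assumes S: "S \<subseteq> carrier D" and meets: "\<And>s t. \<lbrakk>s \<in> S; t \<in> S\<rbrakk> \<Longrightarrow> s \<sqinter> t \<in> S"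
  shows "dba_filter D (up_closure D S)"
  unfolding dba_filter_def
proof (intro conjI ballI impI)
  show "up_closure D S \<subseteq> carrier D"
    by (auto simp: up_closure_def)
next
  fix x y assume "x \<in> up_closure D S" "y \<in> up_closure D S"
  then obtain s t where "x \<in> carrier D" "s \<in> S" "s \<sqsubseteq> x" "y \<in> carrier D" "t \<in> S" "t \<sqsubseteq> y"
    by (auto simp: up_closure_def)
  with S meets show "x \<sqinter> y \<in> up_closure D S"
    by (auto simp: up_closure_def intro!: bexI[where x = "s \<sqinter> t"] meet_mono)
next
  fix x y assume "x \<in> up_closure D S" "y \<in> carrier D" "x \<sqsubseteq> y"
  with S show "y \<in> up_closure D S"
    unfolding up_closure_def using dle_trans by blast
qed

lemma filter_Union_chain:
  assumes chain: "subset.chain {F. dba_filter D F} \<C>"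
  shows "dba_filter D (\<Union>\<C>)"
proof -
  have filt: "\<And>F. F \<in> \<C> \<Longrightarrow> dba_filter D F"
    using chain by (auto simp: subset_chain_def)
  have "x \<sqinter> y \<in> \<Union>\<C>" if "F \<in> \<C>" "G \<in> \<C>" "x \<in> F" "y \<in> G" for F G x y
  proof -
    have "F \<subseteq> G \<or> G \<subseteq> F"
      using chain that by (auto simp: subset_chain_def)
    with that obtain H where "H \<in> \<C>" "x \<in> H" "y \<in> H" by blast
    with filt filter_meet show ?thesis by blast
  qed
  with filt show ?thesis
    unfolding dba_filter_def by (meson Sup_least UnionE UnionI)
qed

lemma meet_mem_vee_ideal_if_maximal:
  assumes P: "dba_filter D P" "P \<noteq> {}" and J: "vee_ideal D J"
    and max: "\<And>G. \<lbrakk>dba_filter D G; G \<inter> J = {}; P \<subseteq> G\<rbrakk> \<Longrightarrow> G = P"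
    and y: "y \<in> carrier D" "y \<notin> P"
  obtains f where "f \<in> P" "f \<sqinter> y \<in> J"
proof -
  let ?S = "(\<lambda>f. f \<sqinter> y) ` P"
  have "(f \<sqinter> y) \<sqinter> (g \<sqinter> y) \<in> ?S" if "f \<in> P" "g \<in> P" for f g
  proof -
    have "(f \<sqinter> y) \<sqinter> (g \<sqinter> y) = (f \<sqinter> g) \<sqinter> y"
      using that y filter_closed[OF P(1)] by (simp add: meet_ac)
    then show ?thesis using filter_meet[OF P(1)] that by blast
  qed
  then have "dba_filter D (up_closure D ?S)"
    using y filter_closed[OF P(1)] by (intro filter_up_closure) auto
  moreover have "P \<subseteq> up_closure D ?S"
    using filter_closed[OF P(1)] y by (auto simp: up_closure_def intro: meet_dle_left)
  moreover have "y \<in> up_closure D ?S"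
    using P filter_closed[OF P(1)] y by (auto simp: up_closure_def intro: meet_dle_right)
  ultimately have "up_closure D ?S \<inter> J \<noteq> {}"
    using max y by metis
  then obtain f w where "f \<in> P" "w \<in> J" "f \<sqinter> y \<sqsubseteq> w"
    by (auto simp: up_closure_def)
  with that show thesis
    using vee_ideal_down[OF J] filter_closed[OF P(1)] y by simp
qed

lemma primary_filter_if_maximal:
  assumes P: "dba_filter D P" "P \<noteq> {}" and J: "vee_ideal D J" and disj: "P \<inter> J = {}"
    and max: "\<And>G. \<lbrakk>dba_filter D G; G \<inter> J = {}; P \<subseteq> G\<rbrakk> \<Longrightarrow> G = P"
  shows "P \<in> primary_filters D"
proof -
  have "y \<in> P \<or> \<^bold>\<not> y \<in> P" if y: "y \<in> carrier D" for y
  proof (rule ccontr)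
    assume "\<not> ?thesis"
    then obtain f g where fg: "f \<in> P" "f \<sqinter> y \<in> J" "g \<in> P" "g \<sqinter> \<^bold>\<not> y \<in> J"
      using meet_mem_vee_ideal_if_maximal[OF P J max] y by (metis neg_closed)
    define k where "k = f \<sqinter> g"
    have carr: "f \<in> carrier D" "g \<in> carrier D" "k \<in> carrier D" "k \<in> meet_part D"
      using fg filter_closed[OF P(1)] by (simp_all add: k_def)
    have "k \<sqinter> y \<sqsubseteq> f \<sqinter> y" "k \<sqinter> \<^bold>\<not> y \<sqsubseteq> g \<sqinter> \<^bold>\<not> y"
      using carr y by (simp_all add: k_def meet_mono meet_dle_left meet_dle_right dle_refl)
    then have "k \<sqinter> y \<in> J" "k \<sqinter> \<^bold>\<not> y \<in> J"
      using vee_ideal_down[OF J fg(2)] vee_ideal_down[OF J fg(4)] carr y by simp_all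
    then have "(k \<sqinter> y) \<^bold>\<or> (k \<sqinter> \<^bold>\<not> y) \<in> J"
      by (rule vee_ideal_vee[OF J])
    also have "(k \<sqinter> y) \<^bold>\<or> (k \<sqinter> \<^bold>\<not> y) = k \<sqinter> (\<top> \<sqinter> \<top>)"
      using carr y by (simp add: vee_neg flip: meet_vee_distrib)
    also have "\<dots> = k"
      using carr by (simp add: meet_right_idem meet_top[of k] meet_part_idem)
    finally show False
      using disj filter_meet[OF P(1)] fg by (auto simp: k_def)
  qed
  moreover have "P \<noteq> carrier D"
    using J disj by (auto simp: vee_ideal_def)
  ultimately show ?thesis
    using P by (simp add: primary_filters_def)
qed

theorem primary_filter_extension:
  assumes F: "dba_filter D F" "F \<noteq> {}" and J: "vee_ideal D J" and disj: "F \<inter> J = {}"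
  obtains P where "P \<in> primary_filters D" "F \<subseteq> P" "P \<inter> J = {}"
proof -
  define \<A> where "\<A> = {G. dba_filter D G \<and> F \<subseteq> G \<and> G \<inter> J = {}}"
  have "\<A> \<noteq> {}"
    using F disj by (auto simp: \<A>_def)
  moreover have "\<Union>\<C> \<in> \<A>" if "\<C> \<noteq> {}" "subset.chain \<A> \<C>" for \<C>
  proof -
    have "dba_filter D (\<Union>\<C>)"
      using that by (intro filter_Union_chain) (auto simp: subset_chain_def \<A>_def)
    with that show ?thesis
      by (auto simp: subset_chain_def \<A>_def)
  qed
  ultimately obtain P where P: "P \<in> \<A>" and max: "\<And>G. \<lbrakk>G \<in> \<A>; P \<subseteq> G\<rbrakk> \<Longrightarrow> G = P"
    using subset_Zorn_nonempty[of \<A>] by metis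
  have "P \<in> primary_filters D"
  proof (rule primary_filter_if_maximal[OF _ _ J])
    fix G assume "dba_filter D G" "G \<inter> J = {}" "P \<subseteq> G"
    with P show "G = P" by (intro max) (auto simp: \<A>_def)
  qed (use P F in \<open>auto simp: \<A>_def\<close>)
  with P that show thesis by (simp add: \<A>_def)
qed

corollary primary_filter_avoiding_vee_ideal:
  assumes p: "p \<in> meet_part D" "p \<notin> J" and J: "vee_ideal D J"
  obtains P where "P \<in> primary_filters D" "p \<in> P" "P \<inter> J = {}"
proof -
  have filt: "dba_filter D (up_closure D {p})"
    using p by (intro filter_up_closure) (auto simp: meet_part_closed meet_part_idem)
  have p_mem: "p \<in> up_closure D {p}"
    using p by (simp add: up_closure_def meet_part_closed dle_refl)
  have disj: "up_closure D {p} \<inter> J = {}"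
    using p vee_ideal_down[OF J] by (auto simp: up_closure_def meet_part_closed)
  obtain P where "P \<in> primary_filters D" "up_closure D {p} \<subseteq> P" "P \<inter> J = {}"
    using primary_filter_extension[OF filt _ J disj] p_mem by blast
  with p_mem that show thesis by blast
qed

lemma vee_ideal_principal:
  assumes "y \<in> carrier D"
  shows "vee_ideal D {x \<in> carrier D. x \<sqsubseteq> y}"
  using assms dle_refl[of y] dle_trans[of _ _ y] by (auto simp: vee_ideal_def vee_least)

lemma vee_ideal_if_ideal:
  assumes "dba_ideal D I" "I \<noteq> {}"
  shows "vee_ideal D I"
proof -
  have "x \<^bold>\<or> y \<in> I" if "x \<in> I" "y \<in> I" for x y
  proof -
    have "x \<in> carrier D" "y \<in> carrier D" "x \<squnion> y \<in> I"
      using assms that by (auto simp: dba_ideal_def)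
    then show ?thesis
      using assms vee_dle_join[of x y] by (simp add: dba_ideal_def)
  qed
  with assms show ?thesis
    by (auto simp: vee_ideal_def dba_ideal_def)
qed

lemma vee_ideal_primary_ideal:
  assumes "I \<in> primary_ideals D"
  shows "vee_ideal D I"
  using assms top_closed by (intro vee_ideal_if_ideal) (auto simp: primary_ideals_def)

end

section \<open>The Stone space of primary filters\<close>

definition finitely_covered :: "('a, 'b) dba_scheme \<Rightarrow> 'a set set set \<Rightarrow> 'a set"
  where "finitely_covered D \<U> =
    {x \<in> carrier D. \<exists>\<F>. finite \<F> \<and> \<F> \<subseteq> \<U> \<and> filters_at D x \<subseteq> \<Union>\<F>}"

context double_boolean_algebra
begin

lemma primary_filter_meet_iff:
  assumes "F \<in> primary_filters D" "x \<in> carrier D" "y \<in> carrier D"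
  shows "x \<sqinter> y \<in> F \<longleftrightarrow> x \<in> F \<and> y \<in> F"
proof -
  have filt: "dba_filter D F"
    using assms by (simp add: primary_filters_def)
  show ?thesis
    using filter_meet[OF filt] filter_up[OF filt] assms
    by (meson meet_closed meet_dle_left meet_dle_right)
qed

lemma bot_notin_primary_filter: "F \<in> primary_filters D \<Longrightarrow> \<bottom> \<notin> F"
  using bot_dle by (auto simp: primary_filters_def dba_filter_def)

lemma primary_filter_neg_iff:
  assumes "F \<in> primary_filters D" "x \<in> carrier D"
  shows "\<^bold>\<not> x \<in> F \<longleftrightarrow> x \<notin> F"
proof -
  have "x \<sqinter> \<^bold>\<not> x \<notin> F"
    using assms by (simp add: meet_neg bot_notin_primary_filter)
  with assms show ?thesis
    by (auto simp: primary_filter_meet_iff primary_filters_def)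
qed

lemma filters_at_subset: "filters_at D x \<subseteq> primary_filters D"
  by (auto simp: filters_at_def)

lemma filters_at_meet:
  assumes "x \<in> carrier D" "y \<in> carrier D"
  shows "filters_at D (x \<sqinter> y) = filters_at D x \<inter> filters_at D y"
  using assms by (auto simp: filters_at_def primary_filter_meet_iff)

lemma filters_at_neg:
  "x \<in> carrier D \<Longrightarrow> filters_at D (\<^bold>\<not> x) = primary_filters D - filters_at D x"
  by (auto simp: filters_at_def primary_filter_neg_iff)

lemma filters_at_vee:
  assumes "x \<in> carrier D" "y \<in> carrier D"
  shows "filters_at D (x \<^bold>\<or> y) = filters_at D x \<union> filters_at D y"
  using assms filters_at_subset by (auto simp: dvee_def filters_at_neg filters_at_meet)

lemma filters_at_bot: "filters_at D \<bottom> = {}"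
  by (auto simp: filters_at_def bot_notin_primary_filter)

lemma filters_at_top: "filters_at D \<top> = primary_filters D"
  using filters_at_neg[of \<top>] filters_at_subset[of \<top>] by (auto simp: neg_top filters_at_bot)

lemma filters_at_mono:
  assumes "y \<in> carrier D" "x \<sqsubseteq> y"
  shows "filters_at D x \<subseteq> filters_at D y"
  using assms by (auto simp: filters_at_def primary_filters_def intro: filter_up)

lemma filters_at_subset_iff:
  assumes p: "p \<in> meet_part D" and y: "y \<in> carrier D"
  shows "filters_at D p \<subseteq> filters_at D y \<longleftrightarrow> p \<sqsubseteq> y"
proof
  assume sub: "filters_at D p \<subseteq> filters_at D y"
  show "p \<sqsubseteq> y"
  proof (rule ccontr)
    assume "\<not> p \<sqsubseteq> y"
    then obtain F where "F \<in> primary_filters D" "p \<in> F" "F \<inter> {x \<in> carrier D. x \<sqsubseteq> y} = {}"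
      using primary_filter_avoiding_vee_ideal[OF p _ vee_ideal_principal[OF y]] by blast
    with sub y dle_refl show False
      by (auto simp: filters_at_def)
  qed
qed (use y in \<open>rule filters_at_mono\<close>)

lemma filters_at_eq_iff:
  assumes "x \<in> carrier D" "y \<in> carrier D"
  shows "filters_at D x = filters_at D y \<longleftrightarrow> x \<sqinter> x = y \<sqinter> y"
proof
  assume "filters_at D x = filters_at D y"
  then have "x \<sqinter> x \<sqsubseteq> y" "y \<sqinter> y \<sqsubseteq> x"
    using assms by (simp_all add: filters_at_meet flip: filters_at_subset_iff)
  then show "x \<sqinter> x = y \<sqinter> y"
    using assms by (metis dle_iff_meet_eq meet_comm meet_idem_left meet_in_meet_part)
next
  assume "x \<sqinter> x = y \<sqinter> y"
  then show "filters_at D x = filters_at D y"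
    using assms filters_at_meet[of x x] filters_at_meet[of y y] by simp
qed

lemma algebra_filters_at: "algebra (primary_filters D) (filters_at D ` carrier D)"
  unfolding algebra_iff_Int
proof (intro conjI ballI)
  show "filters_at D ` carrier D \<subseteq> Pow (primary_filters D)"
    using filters_at_subset by blast
  show "{} \<in> filters_at D ` carrier D"
    using filters_at_bot bot_closed by blast
  fix A assume "A \<in> filters_at D ` carrier D"
  then obtain x where x: "x \<in> carrier D" "A = filters_at D x" by blast
  then show "primary_filters D - A \<in> filters_at D ` carrier D"
    by (metis filters_at_neg image_eqI neg_closed)
  fix B assume "B \<in> filters_at D ` carrier D"
  then obtain y where "y \<in> carrier D" "B = filters_at D y" by blast
  with x show "A \<inter> B \<in> filters_at D ` carrier D"
    by (metis filters_at_meet image_eqI meet_closed)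
qed

lemma obj_top_primary_context:
  "obj_top (primary_context D) =
    closed_subbase_topology (primary_filters D) (filters_at D ` carrier D)"
  by (simp add: primary_context_def)

lemma vee_ideal_finitely_covered: "vee_ideal D (finitely_covered D \<U>)"
  unfolding vee_ideal_def
proof (intro conjI ballI impI)
  show "finitely_covered D \<U> \<subseteq> carrier D"
    by (auto simp: finitely_covered_def)
  have "\<bottom> \<in> finitely_covered D \<U>"
    by (auto simp: finitely_covered_def filters_at_bot)
  then show "finitely_covered D \<U> \<noteq> {}" by blast
next
  fix x y assume "x \<in> finitely_covered D \<U>" "y \<in> finitely_covered D \<U>"
  then obtain \<F> \<G> where "x \<in> carrier D" "finite \<F>" "\<F> \<subseteq> \<U>" "filters_at D x \<subseteq> \<Union>\<F>"
    "y \<in> carrier D" "finite \<G>" "\<G> \<subseteq> \<U>" "filters_at D y \<subseteq> \<Union>\<G>"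
    by (auto simp: finitely_covered_def)
  then have "x \<^bold>\<or> y \<in> carrier D" "finite (\<F> \<union> \<G>)" "\<F> \<union> \<G> \<subseteq> \<U>"
    "filters_at D (x \<^bold>\<or> y) \<subseteq> \<Union>(\<F> \<union> \<G>)"
    by (auto simp: filters_at_vee)
  then show "x \<^bold>\<or> y \<in> finitely_covered D \<U>"
    unfolding finitely_covered_def by blast
next
  fix x y assume "x \<in> finitely_covered D \<U>" and y: "y \<in> carrier D" "y \<sqsubseteq> x"
  then obtain \<F> where "x \<in> carrier D" "finite \<F>" "\<F> \<subseteq> \<U>" "filters_at D x \<subseteq> \<Union>\<F>"
    by (auto simp: finitely_covered_def)
  moreover from this y have "filters_at D y \<subseteq> filters_at D x"
    by (intro filters_at_mono)
  ultimately show "y \<in> finitely_covered D \<U>"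
    using y unfolding finitely_covered_def by blast
qed

theorem compact_space_primary_filters: "compact_space (obj_top (primary_context D))"
  unfolding compact_space_alt topspace_primary_context
proof (intro allI impI, elim conjE)
  fix \<U> assume op: "\<forall>U\<in>\<U>. openin (obj_top (primary_context D)) U"
    and cover: "primary_filters D \<subseteq> \<Union>\<U>"
  interpret algebra "primary_filters D" "filters_at D ` carrier D"
    by (rule algebra_filters_at)
  have "\<top> \<sqinter> \<top> \<in> finitely_covered D \<U>"
  proof (rule ccontr)
    assume "\<top> \<sqinter> \<top> \<notin> finitely_covered D \<U>"
    then obtain F where F: "F \<in> primary_filters D" "F \<inter> finitely_covered D \<U> = {}"
      using primary_filter_avoiding_vee_ideal[OF meet_in_meet_part[OF top_closed top_closed] _
          vee_ideal_finitely_covered] by blast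
    then obtain U where U: "U \<in> \<U>" "F \<in> U"
      using cover by blast
    then obtain x where x: "x \<in> carrier D" "F \<in> filters_at D x" "filters_at D x \<subseteq> U"
      using op unfolding obj_top_primary_context openin_closed_subbase_topology_iff by blast
    then have "finite {U}" "{U} \<subseteq> \<U>" "filters_at D x \<subseteq> \<Union>{U}"
      using U by simp_all
    with x(1) have "x \<in> finitely_covered D \<U>"
      unfolding finitely_covered_def by blast
    with F x show False
      by (auto simp: filters_at_def)
  qed
  then show "\<exists>\<F>. finite \<F> \<and> \<F> \<subseteq> \<U> \<and> primary_filters D \<subseteq> \<Union>\<F>"
    by (simp add: finitely_covered_def filters_at_meet filters_at_top)
qed

lemma clopen_iff_filters_at:
  "closedin (obj_top (primary_context D)) A \<and> openin (obj_top (primary_context D)) A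
    \<longleftrightarrow> A \<in> filters_at D ` carrier D"
  using algebra.clopen_closed_subbase_topology_iff[OF algebra_filters_at]
    compact_space_primary_filters
  by (simp add: obj_top_primary_context)

lemma primary_filter_disjoint_iff:
  assumes I: "I \<in> primary_ideals D" and x: "x \<in> carrier D"
  shows "(\<exists>F\<in>primary_filters D. x \<in> F \<and> F \<inter> I = {}) \<longleftrightarrow> x \<sqinter> x \<notin> I"
proof -
  have "x \<sqinter> x \<in> F \<longleftrightarrow> x \<in> F" if "F \<in> primary_filters D" for F
    using primary_filter_meet_iff[OF that x x] by simp
  moreover have "\<exists>F\<in>primary_filters D. x \<sqinter> x \<in> F \<and> F \<inter> I = {}" if "x \<sqinter> x \<notin> I"
    using primary_filter_avoiding_vee_ideal[OF meet_in_meet_part[OF x x] that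
        vee_ideal_primary_ideal[OF I]] by blast
  ultimately show ?thesis by blast
qed

end

section \<open>Duality\<close>

definition dual_dba :: "('a, 'b) dba_scheme \<Rightarrow> 'a dba"
  where "dual_dba D = \<lparr>carrier = carrier D, djoin = dmeet D, dmeet = djoin D,
    dneg = dopp D, dopp = dneg D, dtop = dbot D, dbot = dtop D\<rparr>"

lemma dual_dba_simps [simp]:
  "carrier (dual_dba D) = carrier D"
  "djoin (dual_dba D) = dmeet D"
  "dmeet (dual_dba D) = djoin D"
  "dneg (dual_dba D) = dopp D"
  "dopp (dual_dba D) = dneg D"
  "dtop (dual_dba D) = dbot D"
  "dbot (dual_dba D) = dtop D"
  "dvee (dual_dba D) = dwedge D"
  "dwedge (dual_dba D) = dvee D"
  "meet_part (dual_dba D) = join_part D"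
  by (simp_all add: dual_dba_def dvee_def dwedge_def fun_eq_iff meet_part_def join_part_def)

context double_boolean_algebra
begin

lemma double_boolean_algebra_dual: "double_boolean_algebra (dual_dba D)"
  by (unfold_locales; unfold dual_dba_simps)
    (rule join_closed meet_closed neg_closed opp_closed top_closed bot_closed
      meet_idem_left meet_comm meet_assoc neg_meet_idem meet_join_absorb meet_vee_distrib
      meet_vee_absorb neg_neg_meet meet_neg neg_bot neg_top join_idem_left join_comm join_assoc
      opp_join_idem join_meet_absorb join_wedge_distrib join_wedge_absorb opp_opp_join
      join_opp opp_top opp_bot meet_join_idem meet_join_idem[symmetric]; assumption)+

lemma dle_dual_iff:
  assumes "x \<in> carrier D" "y \<in> carrier D"
  shows "x \<sqsubseteq>\<^bsub>dual_dba D\<^esub> y \<longleftrightarrow> y \<sqsubseteq> x"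
  using assms by (auto simp: dle_def meet_comm join_comm)

lemma primary_filters_dual: "primary_filters (dual_dba D) = primary_ideals D"
proof -
  have "dba_filter (dual_dba D) I \<longleftrightarrow> dba_ideal D I" for I
    unfolding dba_filter_def dba_ideal_def dual_dba_simps using dle_dual_iff by blast
  then show ?thesis
    by (simp add: primary_filters_def primary_ideals_def)
qed

lemma primary_ideals_dual: "primary_ideals (dual_dba D) = primary_filters D"
proof -
  have "dba_ideal (dual_dba D) F \<longleftrightarrow> dba_filter D F" for F
    unfolding dba_filter_def dba_ideal_def dual_dba_simps using dle_dual_iff by blast
  then show ?thesis
    by (simp add: primary_filters_def primary_ideals_def)
qed

lemma filters_at_dual: "filters_at (dual_dba D) = ideals_at D"
  by (simp add: filters_at_def ideals_at_def primary_filters_dual fun_eq_iff)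

lemma obj_top_primary_context_dual:
  "obj_top (primary_context (dual_dba D)) = attr_top (primary_context D)"
  by (simp add: primary_context_def primary_filters_dual filters_at_dual)

interpretation dual: double_boolean_algebra "dual_dba D"
  rewrites "carrier (dual_dba D) = carrier D"
    and "djoin (dual_dba D) = dmeet D"
    and "dmeet (dual_dba D) = djoin D"
    and "dneg (dual_dba D) = dopp D"
    and "dtop (dual_dba D) = dbot D"
    and "dbot (dual_dba D) = dtop D"
    and "meet_part (dual_dba D) = join_part D"
    and "primary_filters (dual_dba D) = primary_ideals D"
    and "primary_ideals (dual_dba D) = primary_filters D"
    and "filters_at (dual_dba D) = ideals_at D"
    and "obj_top (primary_context (dual_dba D)) = attr_top (primary_context D)"
  by (simp_all add: double_boolean_algebra_dual primary_filters_dual primary_ideals_dual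
      filters_at_dual obj_top_primary_context_dual)

lemmas join_in_join_part = dual.meet_in_meet_part
  and opp_in_join_part = dual.neg_in_meet_part
  and join_part_idem = dual.meet_part_idem
  and ideals_at_subset = dual.filters_at_subset
  and ideals_at_join = dual.filters_at_meet
  and ideals_at_opp = dual.filters_at_neg
  and ideals_at_top = dual.filters_at_bot
  and ideals_at_bot = dual.filters_at_top
  and ideals_at_eq_iff = dual.filters_at_eq_iff
  and clopen_iff_ideals_at = dual.clopen_iff_filters_at
  and primary_ideal_disjoint_iff = dual.primary_filter_disjoint_iff

section \<open>The representation by clopen protoconcepts\<close>

lemma nec_primary_context:
  "nec (primary_context D) A =
    {I \<in> primary_ideals D. \<forall>F\<in>primary_filters D. F \<inter> I = {} \<longrightarrow> F \<in> A}"
  unfolding nec_def topspace_primary_context by (auto simp: primary_context_def)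

lemma poss_primary_context:
  "poss (primary_context D) B =
    {F \<in> primary_filters D. \<exists>I\<in>primary_ideals D. I \<inter> F = {} \<and> I \<in> B}"
  unfolding poss_def topspace_primary_context by (auto simp: primary_context_def)

lemma nec_filters_at:
  assumes "x \<in> carrier D"
  shows "nec (primary_context D) (filters_at D x) = ideals_at D (\<^bold>\<not> x)"
proof -
  have "(\<forall>F\<in>primary_filters D. F \<inter> I = {} \<longrightarrow> x \<in> F) \<longleftrightarrow> \<^bold>\<not> x \<in> I" if "I \<in> primary_ideals D" for I
    using primary_filter_disjoint_iff[OF that, of "\<^bold>\<not> x"] assms
    by (auto simp: primary_filter_neg_iff meet_part_idem)
  then show ?thesis
    by (auto simp: nec_primary_context filters_at_def ideals_at_def)
qed

lemma poss_ideals_at: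
  assumes "x \<in> carrier D"
  shows "poss (primary_context D) (ideals_at D x) = filters_at D (\<^bold>\<not> (x \<squnion> x))"
proof -
  have "(\<exists>I\<in>primary_ideals D. x \<in> I \<and> I \<inter> F = {}) \<longleftrightarrow> \<^bold>\<not> (x \<squnion> x) \<in> F"
    if "F \<in> primary_filters D" for F
    using primary_ideal_disjoint_iff[OF that assms] that assms
    by (simp add: primary_filter_neg_iff)
  then show ?thesis
    by (auto simp: poss_primary_context filters_at_def ideals_at_def)
qed

end

definition canonical_protoconcept :: "('a, 'b) dba_scheme \<Rightarrow> 'a \<Rightarrow> 'a set set \<times> 'a set set"
  where "canonical_protoconcept D = (\<lambda>x. (filters_at D (\<^bold>\<not>\<^bsub>D\<^esub> x), ideals_at D x))"

context double_boolean_algebra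
begin

abbreviation canonical_algebra :: "('a set set \<times> 'a set set) dba"
  where "canonical_algebra \<equiv> clopen_oo_protoconcept_algebra (primary_context D)"

lemma canonical_protoconcept_join:
  assumes "x \<in> carrier D" "y \<in> carrier D"
  shows "canonical_protoconcept D (x \<squnion> y)
    = canonical_protoconcept D x \<squnion>\<^bsub>canonical_algebra\<^esub> canonical_protoconcept D y"
  using poss_ideals_at[of "x \<squnion> y"] assms
  by (simp add: canonical_protoconcept_def clopen_oo_protoconcept_algebra_def ideals_at_join
      join_in_join_part join_part_idem)

lemma canonical_protoconcept_meet:
  assumes "x \<in> carrier D" "y \<in> carrier D"
  shows "canonical_protoconcept D (x \<sqinter> y)
    = canonical_protoconcept D x \<sqinter>\<^bsub>canonical_algebra\<^esub> canonical_protoconcept D y"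
proof -
  have "filters_at D (\<^bold>\<not> x) \<union> filters_at D (\<^bold>\<not> y) = filters_at D (\<^bold>\<not> (x \<sqinter> y))"
    using assms by (auto simp: filters_at_neg filters_at_meet)
  then show ?thesis
    using assms
    by (simp add: canonical_protoconcept_def clopen_oo_protoconcept_algebra_def nec_filters_at
        neg_neg_meet)
qed

lemma canonical_protoconcept_neg:
  assumes "x \<in> carrier D"
  shows "canonical_protoconcept D (\<^bold>\<not> x) = \<^bold>\<not>\<^bsub>canonical_algebra\<^esub> canonical_protoconcept D x"
proof -
  have "primary_filters D - filters_at D (\<^bold>\<not> x) = filters_at D (\<^bold>\<not> (\<^bold>\<not> x))"
    using assms by (simp add: filters_at_neg)
  then show ?thesis
    using assms
    by (simp add: canonical_protoconcept_def clopen_oo_protoconcept_algebra_def nec_filters_at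
        neg_neg[of "\<^bold>\<not> x"] meet_part_idem)
qed

lemma canonical_protoconcept_opp:
  assumes "x \<in> carrier D"
  shows "canonical_protoconcept D (\<^bold>\<rfloor> x) = \<^bold>\<rfloor>\<^bsub>canonical_algebra\<^esub> canonical_protoconcept D x"
  using poss_ideals_at[of "\<^bold>\<rfloor> x"] assms
  by (simp add: canonical_protoconcept_def clopen_oo_protoconcept_algebra_def ideals_at_opp
      opp_in_join_part join_part_idem)

lemma canonical_protoconcept_top:
  "canonical_protoconcept D \<top> = \<top>\<^bsub>canonical_algebra\<^esub>"
  by (simp add: canonical_protoconcept_def clopen_oo_protoconcept_algebra_def neg_top
      filters_at_bot ideals_at_top)

lemma canonical_protoconcept_bot:
  "canonical_protoconcept D \<bottom> = \<bottom>\<^bsub>canonical_algebra\<^esub>"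
  by (simp add: canonical_protoconcept_def clopen_oo_protoconcept_algebra_def neg_bot
      filters_at_meet filters_at_top ideals_at_bot)

lemma poss_nec_filters_at:
  assumes "x \<in> carrier D"
  shows "poss (primary_context D) (nec (primary_context D) (filters_at D (\<^bold>\<not> x)))
    = filters_at D (\<^bold>\<not> (x \<squnion> x))"
  using assms by (simp add: nec_filters_at neg_neg poss_ideals_at meet_join_idem neg_meet_idem)

lemma canonical_protoconcept_closed:
  assumes "x \<in> carrier D"
  shows "canonical_protoconcept D x \<in> carrier canonical_algebra"
  using assms filters_at_subset ideals_at_subset
    clopen_iff_filters_at[of "filters_at D (\<^bold>\<not> x)"] clopen_iff_ideals_at[of "ideals_at D x"]
  by (simp add: canonical_protoconcept_def clopen_oo_protoconcept_algebra_def
      clopen_oo_protoconcepts_def oo_protoconcepts_def poss_nec_filters_at poss_ideals_at)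

lemma canonical_algebra_elem_parts:
  assumes "(A, B) \<in> carrier canonical_algebra"
  obtains p q where "p \<in> meet_part D" "q \<in> join_part D" "p \<squnion> p = q \<sqinter> q"
    "A = filters_at D (\<^bold>\<not> p)" "B = ideals_at D q"
proof -
  let ?K = "primary_context D"
  have proto: "poss ?K (nec ?K A) = poss ?K B"
    and A: "closedin (obj_top ?K) A \<and> openin (obj_top ?K) A"
    and B: "closedin (attr_top ?K) B \<and> openin (attr_top ?K) B"
    using assms
    by (auto simp: clopen_oo_protoconcept_algebra_def clopen_oo_protoconcepts_def
        oo_protoconcepts_def)
  from A obtain a where a: "a \<in> carrier D" "A = filters_at D a"
    by (auto simp: clopen_iff_filters_at)
  from B obtain b where b: "b \<in> carrier D" "B = ideals_at D b"
    by (auto simp: clopen_iff_ideals_at)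
  define p where "p = \<^bold>\<not> a"
  define q where "q = b \<squnion> b"
  have p: "p \<in> carrier D" "p \<in> meet_part D" and q: "q \<in> carrier D" "q \<in> join_part D"
    using a b by (simp_all add: p_def q_def join_in_join_part)
  have A_eq: "A = filters_at D (\<^bold>\<not> p)" and B_eq: "B = ideals_at D q"
    using a b by (simp_all add: p_def q_def neg_neg filters_at_meet ideals_at_join)
  have "filters_at D (\<^bold>\<not> (p \<squnion> p)) = filters_at D (\<^bold>\<not> q)"
    using proto p q by (simp add: A_eq B_eq poss_nec_filters_at poss_ideals_at join_part_idem)
  then have "(p \<squnion> p) \<sqinter> (p \<squnion> p) = q \<sqinter> q"
    using p q by (simp add: filters_at_eq_iff meet_part_idem neg_eq_iff)
  then have "p \<squnion> p = q \<sqinter> q"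
    using p meet_join_idem[of p] by (simp add: meet_part_idem)
  with that p q A_eq B_eq show thesis by blast
qed

end

lemma (in contextual_dba) inj_on_canonical_protoconcept:
  "inj_on (canonical_protoconcept D) (carrier D)"
proof (rule inj_onI)
  fix x y assume xy: "x \<in> carrier D" "y \<in> carrier D"
    and "canonical_protoconcept D x = canonical_protoconcept D y"
  then have "filters_at D (\<^bold>\<not> x) = filters_at D (\<^bold>\<not> y)" "ideals_at D x = ideals_at D y"
    by (simp_all add: canonical_protoconcept_def)
  then have "x \<sqinter> x = y \<sqinter> y" "x \<squnion> x = y \<squnion> y"
    using xy by (simp_all add: filters_at_eq_iff ideals_at_eq_iff meet_part_idem neg_eq_iff)
  then show "x = y"
    by (rule eq_if_parts_eq[OF xy])
qed

lemma (in fully_contextual_dba) canonical_protoconcept_image: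
  "canonical_protoconcept D ` carrier D = carrier canonical_algebra"
proof (intro equalityI subsetI)
  fix P assume "P \<in> carrier canonical_algebra"
  then obtain A B where P: "P = (A, B)" "(A, B) \<in> carrier canonical_algebra"
    by (cases P) auto
  obtain p q where pq: "p \<in> meet_part D" "q \<in> join_part D" "p \<squnion> p = q \<sqinter> q"
    "A = filters_at D (\<^bold>\<not> p)" "B = ideals_at D q"
    by (rule canonical_algebra_elem_parts[OF P(2)])
  then obtain z where z: "z \<in> carrier D" "z \<sqinter> z = p" "z \<squnion> z = q"
    using ex1_glue by blast
  have "filters_at D (\<^bold>\<not> z) = A" "ideals_at D z = B"
    using z neg_meet_idem[of z] ideals_at_join[of z z] pq by simp_all
  with z P show "P \<in> canonical_protoconcept D ` carrier D"
    by (auto simp: canonical_protoconcept_def)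
qed (use canonical_protoconcept_closed in blast)

theorem mainTheorem2:
  fixes D :: "('a, 'b) dba_scheme"
  assumes "fully_contextual_dba D"
  shows "(\<lambda>x. (filters_at D (\<^bold>\<not>\<^bsub>D\<^esub> x), ideals_at D x))
           \<in> dba_iso D (clopen_oo_protoconcept_algebra (primary_context D))
         \<and> dba_isomorphic D (clopen_oo_protoconcept_algebra (primary_context D))"
proof -
  interpret fully_contextual_dba D by (rule assms)
  have "bij_betw (canonical_protoconcept D) (carrier D) (carrier canonical_algebra)"
    using inj_on_canonical_protoconcept canonical_protoconcept_image
    by (simp add: bij_betw_def)
  then have "canonical_protoconcept D \<in> dba_iso D canonical_algebra"
    by (simp add: dba_iso_def canonical_protoconcept_join canonical_protoconcept_meet
        canonical_protoconcept_neg canonical_protoconcept_opp canonical_protoconcept_top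
        canonical_protoconcept_bot)
  then show ?thesis
    unfolding canonical_protoconcept_def dba_isomorphic_def by blast
qed

end
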